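(* Let $0\le T_0<T_1\le+\infty$, let $\Gamma$ be a network with Hamiltonians $\{H_\gamma\}$ and flux limiter $x\mapsto c_x$ as described in the context. Let $u$, $v$ be uniformly continuous functions on $(\Gamma\times\{T_0\})\cup(\mathbf{V}\times[T_0,T_1))$ which are respectively a subsolution and a supersolution of the semidiscrete equation (Discr) in $(T_0,T_1)$, with $u(\cdot,T_0)\le v(\cdot,T_0)$ in $\mathbf{V}$. Then $u\le v$ on $\mathbf{V}\times[T_0,T_1)$.
   Context: Network. $\Gamma=\bigcup_{\gamma\in\mathcal{E}}\gamma([0,1])\subset\mathbb{R}^N$, where $\mathcal{E}$ is a finite collection of arcs, i.e. simple $C^1$ curves $\gamma:[0,1]\to\mathbb{R}^N$ with nonvanishing derivative. Together with each arc $\gamma$ one also considers its inverse arc $-\gamma(s)=\gamma(1-s)$ (so the collection of arcs is regarded as closed under inversion). It is assumed that $\gamma((0,1))\cap\gamma'([0,1])=\emptyset$ whenever $\gamma'\ne\gamma$, $\gamma'\neq-\gamma$. Vertices are the initial and terminal points of arcs; $\mathbf{V}$ is the set of vertices. The network is connected (any two vertices are linked by a finite concatenation of arcs) and has no loops ($\gamma(0)\ne\gamma(1)$ for every arc). For $x\in\mathbf{V}$, $\Gamma_x=\{\gamma : \gamma(1)=x\}$. Hamiltonians. For each arc $\gamma$ a function $H_\gamma:[0,1]\times\mathbb{R}\to\mathbb{R}$ is given, with $H_{-\gamma}(s,p)=H_\gamma(1-s,-p)$. Each $H_\gamma$ is continuous in $(s,p)$, convex in $p$, coercive in $p$ uniformly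 in $s$, and for every $M>0$ there is $C_M$ with $H_\gamma(s,p)-H_\gamma(s,q)\le C_M|p-q|$ for all $s\in[0,1]$, $p,q\in(-M,M)$. Moreover all $H_\gamma$ are strictly positive (standing normalization). Set $c_\gamma=-\max_{s\in[0,1]}\min_{p\in\mathbb{R}}H_\gamma(s,p)$. A flux limiter is a function $x\mapsto c_x$ from $\mathbf{V}$ to $\mathbb{R}$ with $c_x\le\min_{\gamma\in\Gamma_x}c_\gamma$ for all $x$ (hence $c_x<0$). (HJ$_\gamma$) is the equation $w_t+H_\gamma(s,w')=0$, in the viscosity sense, where $'$ denotes the derivative in $s$. Semidiscrete equation. Let $R=(0,1)\times(T_0,T_1)$, and let $\mathcal{F}$ be the space of uniformly continuous real functions on $(\Gamma\times\{T_0\})\cup(\mathbf{V}\times[T_0,T_1))$. For $u\in\mathcal{F}$ and an arc $\gamma$, $F_\gamma[u]$ is the maximal (pointwise largest) uniformly continuous subsolution of (HJ$_\gamma$) in $R$ (extended by continuity to the boundary) among those which are $\le u(\gamma(s),T_0)$ at $(s,T_0)$, $s\in[0,1]$, and $\le u(\gamma(0),t)$ at $(0,t)$, $t\in(T_0,T_1)$; it exists and is uniformly continuous. For $x\in\mathbf{V}$ put $F_x[u](t)=\min_{\gamma\in\Gamma_x}F_\gamma[u](1,t)$, $t\in[T_0,T_1)$. For $\psi$ continuous on $[T_0,T_1)$ and $a<0$ put $G[\psi,a](t)=\min\{\psi(r)+a(t-r) : r\in[T_0,t]\}$. The semidiscrete equation is $$u(x,t)=G[F_x[u],c_x](t).\qquad\text{(Discr)}$$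 A uniformly continuous subsolution (resp. supersolution, solution) of (Discr) in $(T_0,T_1)$ is a $u\in\mathcal{F}$ with $u(x,t)\le$ (resp. $\ge$, $=$) $G[F_x[u],c_x](t)$ for all $(x,t)\in\mathbf{V}\times(T_0,T_1)$.
   Formalization: The initial ordering u(·,T_0) ≤ v(·,T_0) is assumed on all of Γ, not only on V; with ordering only on V the claim is false, since F_γ[u] depends on the initial data inside the arcs. *)

theory Defs
  imports "HOL-Analysis.Analysis"
begin

section \<open>Networks\<close>

text \<open>Arcs are parametrized on \<^term>\<open>{0..1::real}\<close>; derivatives at the end points are one-sided,
  so that the values of an arc outside the unit interval play no role.\<close>

definition C1_regular_curve :: "(real \<Rightarrow> 'a::real_normed_vector) \<Rightarrow> bool" where
  "C1_regular_curve \<gamma> \<longleftrightarrow>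
     (\<exists>D. (\<forall>s\<in>{0..1}. (\<gamma> has_vector_derivative D s) (at s within {0..1})) \<and>
          continuous_on {0..1} D \<and> (\<forall>s\<in>{0..1}. D s \<noteq> 0))"

definition network_points :: "(real \<Rightarrow> 'a) set \<Rightarrow> 'a set" where
  "network_points E = (\<Union>\<gamma>\<in>E. \<gamma> ` {0..1})"

definition vertices :: "(real \<Rightarrow> 'a::topological_space) set \<Rightarrow> 'a set" where
  "vertices E = pathstart ` E \<union> pathfinish ` E"

definition arcs_to :: "(real \<Rightarrow> 'a::topological_space) set \<Rightarrow> 'a \<Rightarrow> (real \<Rightarrow> 'a) set" where
  "arcs_to E x = {\<gamma>\<in>E. pathfinish \<gamma> = x}"

text \<open>The collection of arcs contains, with each arc, its inverse \<^const>\<open>reversepath\<close>.\<close>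

definition network :: "(real \<Rightarrow> 'a::real_normed_vector) set \<Rightarrow> bool" where
  "network E \<longleftrightarrow>
     finite E \<and>
     (\<forall>\<gamma>\<in>E. simple_path \<gamma> \<and> C1_regular_curve \<gamma>) \<and>
     (\<forall>\<gamma>\<in>E. reversepath \<gamma> \<in> E) \<and>
     (\<forall>\<gamma>\<in>E. \<forall>\<gamma>'\<in>E. \<gamma>' \<noteq> \<gamma> \<longrightarrow> \<gamma>' \<noteq> reversepath \<gamma> \<longrightarrow> \<gamma> ` {0<..<1} \<inter> \<gamma>' ` {0..1} = {}) \<and>
     (\<forall>x\<in>vertices E. \<forall>y\<in>vertices E. (x, y) \<in> {(pathstart \<gamma>, pathfinish \<gamma>) | \<gamma>. \<gamma> \<in> E}\<^sup>*) \<and>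
     (\<forall>\<gamma>\<in>E. pathstart \<gamma> \<noteq> pathfinish \<gamma>)"

section \<open>Hamiltonians and flux limiters\<close>

definition hamiltonian :: "(real \<Rightarrow> real \<Rightarrow> real) \<Rightarrow> bool" where
  "hamiltonian h \<longleftrightarrow>
     continuous_on ({0..1} \<times> UNIV) (\<lambda>(s, p). h s p) \<and>
     (\<forall>s\<in>{0..1}. convex_on UNIV (h s)) \<and>
     (\<forall>K. \<exists>R. \<forall>s\<in>{0..1}. \<forall>p. \<bar>p\<bar> \<ge> R \<longrightarrow> h s p \<ge> K) \<and>
     (\<forall>M>0. \<exists>C. \<forall>s\<in>{0..1}. \<forall>p\<in>{-M<..<M}. \<forall>q\<in>{-M<..<M}. h s p - h s q \<le> C * \<bar>p - q\<bar>) \<and>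
     (\<forall>s\<in>{0..1}. \<forall>p. h s p > 0)"

definition network_hamiltonians ::
  "(real \<Rightarrow> 'a::topological_space) set \<Rightarrow> ((real \<Rightarrow> 'a) \<Rightarrow> real \<Rightarrow> real \<Rightarrow> real) \<Rightarrow> bool" where
  "network_hamiltonians E H \<longleftrightarrow>
     (\<forall>\<gamma>\<in>E. hamiltonian (H \<gamma>)) \<and>
     (\<forall>\<gamma>\<in>E. \<forall>s\<in>{0..1}. \<forall>p. H (reversepath \<gamma>) s p = H \<gamma> (1 - s) (- p))"

text \<open>For a \<^const>\<open>hamiltonian\<close> the supremum and the infimum are a maximum and a minimum.\<close>

definition arc_constant :: "(real \<Rightarrow> real \<Rightarrow> real) \<Rightarrow> real" where
  "arc_constant h = - (SUP s\<in>{0..1}. INF p. h s p)"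

definition flux_limiter ::
  "(real \<Rightarrow> 'a::topological_space) set \<Rightarrow> ((real \<Rightarrow> 'a) \<Rightarrow> real \<Rightarrow> real \<Rightarrow> real) \<Rightarrow> ('a \<Rightarrow> real) \<Rightarrow> bool" where
  "flux_limiter E H c \<longleftrightarrow>
     (\<forall>x\<in>vertices E. c x \<le> Min ((\<lambda>\<gamma>. arc_constant (H \<gamma>)) ` arcs_to E x))"

section \<open>The evolutionary equation on an arc\<close>

text \<open>The final time may be infinite, hence an extended real.\<close>

definition times_co :: "real \<Rightarrow> ereal \<Rightarrow> real set" where
  "times_co T0 T1 = {t. T0 \<le> t \<and> ereal t < T1}"

definition times_oo :: "real \<Rightarrow> ereal \<Rightarrow> real set" where
  "times_oo T0 T1 = {t. T0 < t \<and> ereal t < T1}"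

text \<open>Viscosity subsolutions of \<open>w\<^sub>t + h(s, w') = 0\<close> in an open set \<open>R\<close> of the \<open>(s, t)\<close>-plane:
  \<open>\<phi>\<close> is a \<open>C\<^sup>1\<close> test function with partial derivatives \<open>\<phi>s\<close> and \<open>\<phi>t\<close>, touching \<open>w\<close> from above
  (up to an additive constant) at \<open>(s, t)\<close>.\<close>

definition viscosity_subsolution ::
  "(real \<Rightarrow> real \<Rightarrow> real) \<Rightarrow> (real \<times> real) set \<Rightarrow> (real \<times> real \<Rightarrow> real) \<Rightarrow> bool" where
  "viscosity_subsolution h R w \<longleftrightarrow>
     (\<forall>\<phi> \<phi>s \<phi>t s t.
        (\<forall>z\<in>R. (\<phi> has_derivative (\<lambda>(a, b). \<phi>s z * a + \<phi>t z * b)) (at z)) \<longrightarrow>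
        continuous_on R \<phi>s \<longrightarrow> continuous_on R \<phi>t \<longrightarrow>
        (s, t) \<in> R \<longrightarrow>
        (\<forall>\<^sub>F z in nhds (s, t). w z - \<phi> z \<le> w (s, t) - \<phi> (s, t)) \<longrightarrow>
        \<phi>t (s, t) + h s (\<phi>s (s, t)) \<le> 0)"

text \<open>Uniformly continuous subsolutions in \<open>(0,1) \<times> (T0,T1)\<close>, below \<open>f\<close> at the initial time and
  below \<open>g\<close> on the side \<open>s = 0\<close>; there is no condition on the side \<open>s = 1\<close>. Extension by continuity
  to the boundary is encoded by uniform continuity on \<open>[0,1] \<times> [T0,T1)\<close>.\<close>

definition admissible_subsolution ::
  "(real \<Rightarrow> real \<Rightarrow> real) \<Rightarrow> real \<Rightarrow> ereal \<Rightarrow> (real \<Rightarrow> real) \<Rightarrow> (real \<Rightarrow> real) \<Rightarrow>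
   (real \<times> real \<Rightarrow> real) \<Rightarrow> bool" where
  "admissible_subsolution h T0 T1 f g w \<longleftrightarrow>
     uniformly_continuous_on ({0..1} \<times> times_co T0 T1) w \<and>
     viscosity_subsolution h ({0<..<1} \<times> times_oo T0 T1) w \<and>
     (\<forall>s\<in>{0..1}. w (s, T0) \<le> f s) \<and>
     (\<forall>t\<in>times_oo T0 T1. w (0, t) \<le> g t)"

definition maximal_subsolution ::
  "(real \<Rightarrow> real \<Rightarrow> real) \<Rightarrow> real \<Rightarrow> ereal \<Rightarrow> (real \<Rightarrow> real) \<Rightarrow> (real \<Rightarrow> real) \<Rightarrow>
   (real \<times> real \<Rightarrow> real) \<Rightarrow> bool" where
  "maximal_subsolution h T0 T1 f g W \<longleftrightarrow>
     admissible_subsolution h T0 T1 f g W \<and>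
     (\<forall>w. admissible_subsolution h T0 T1 f g w \<longrightarrow>
        (\<forall>z\<in>{0..1} \<times> times_co T0 T1. w z \<le> W z))"

section \<open>The semidiscrete equation\<close>

definition semidiscrete_domain ::
  "(real \<Rightarrow> 'a::topological_space) set \<Rightarrow> real \<Rightarrow> ereal \<Rightarrow> ('a \<times> real) set" where
  "semidiscrete_domain E T0 T1 = network_points E \<times> {T0} \<union> vertices E \<times> times_co T0 T1"

text \<open>\<open>F \<gamma>\<close> is \<open>F\<^sub>\<gamma>[u]\<close>. Pointwise maximality determines it uniquely on \<open>[0,1] \<times> [T0,T1)\<close>; since its
  values elsewhere are irrelevant, it is given as a relation between \<open>u\<close> and \<open>F\<close>.\<close>

definition arc_operator ::
  "(real \<Rightarrow> 'a::topological_space) set \<Rightarrow> ((real \<Rightarrow> 'a) \<Rightarrow> real \<Rightarrow> real \<Rightarrow> real) \<Rightarrow> real \<Rightarrow> ereal \<Rightarrow>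
   ('a \<times> real \<Rightarrow> real) \<Rightarrow> ((real \<Rightarrow> 'a) \<Rightarrow> real \<times> real \<Rightarrow> real) \<Rightarrow> bool" where
  "arc_operator E H T0 T1 u F \<longleftrightarrow>
     (\<forall>\<gamma>\<in>E. maximal_subsolution (H \<gamma>) T0 T1 (\<lambda>s. u (\<gamma> s, T0)) (\<lambda>t. u (pathstart \<gamma>, t)) (F \<gamma>))"

definition vertex_operator ::
  "(real \<Rightarrow> 'a::topological_space) set \<Rightarrow> ((real \<Rightarrow> 'a) \<Rightarrow> real \<times> real \<Rightarrow> real) \<Rightarrow> 'a \<Rightarrow> real \<Rightarrow> real" where
  "vertex_operator E F x t = Min ((\<lambda>\<gamma>. F \<gamma> (1, t)) ` arcs_to E x)"

text \<open>For continuous \<open>\<psi>\<close> the infimum is a minimum.\<close>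

definition flux_operator :: "real \<Rightarrow> (real \<Rightarrow> real) \<Rightarrow> real \<Rightarrow> real \<Rightarrow> real" where
  "flux_operator T0 \<psi> a t = (INF r\<in>{T0..t}. \<psi> r + a * (t - r))"

definition semidiscrete_subsolution ::
  "(real \<Rightarrow> 'a::metric_space) set \<Rightarrow> ((real \<Rightarrow> 'a) \<Rightarrow> real \<Rightarrow> real \<Rightarrow> real) \<Rightarrow> ('a \<Rightarrow> real) \<Rightarrow>
   real \<Rightarrow> ereal \<Rightarrow> ('a \<times> real \<Rightarrow> real) \<Rightarrow> bool" where
  "semidiscrete_subsolution E H c T0 T1 u \<longleftrightarrow>
     uniformly_continuous_on (semidiscrete_domain E T0 T1) u \<and>
     (\<exists>F. arc_operator E H T0 T1 u F \<and>
        (\<forall>x\<in>vertices E. \<forall>t\<in>times_oo T0 T1.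
           u (x, t) \<le> flux_operator T0 (vertex_operator E F x) (c x) t))"

definition semidiscrete_supersolution ::
  "(real \<Rightarrow> 'a::metric_space) set \<Rightarrow> ((real \<Rightarrow> 'a) \<Rightarrow> real \<Rightarrow> real \<Rightarrow> real) \<Rightarrow> ('a \<Rightarrow> real) \<Rightarrow>
   real \<Rightarrow> ereal \<Rightarrow> ('a \<times> real \<Rightarrow> real) \<Rightarrow> bool" where
  "semidiscrete_supersolution E H c T0 T1 v \<longleftrightarrow>
     uniformly_continuous_on (semidiscrete_domain E T0 T1) v \<and>
     (\<exists>F. arc_operator E H T0 T1 v F \<and>
        (\<forall>x\<in>vertices E. \<forall>t\<in>times_oo T0 T1.
           v (x, t) \<ge> flux_operator T0 (vertex_operator E F x) (c x) t))"

text \<open>A comparison principle for these notions needs the initial data to be ordered on the whole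
  network, not only on the vertices, because \<open>F\<^sub>\<gamma>[u]\<close> depends on \<open>u(\<gamma>(s), T0)\<close> for all
  \<open>s\<close>. For instance, on a single arc (and its inverse) take \<open>H(s, p) = \<bar>p\<bar> + 1\<close>, \<open>c = -1\<close>,
  \<open>T0 = 0\<close>, \<open>T1 = \<infinity>\<close>. Both \<open>u = -t\<close> and the function \<open>v\<close> with
  \<open>v(\<gamma>(s), 0) = - min(s, 1 - s)\<close> and \<open>v(x, t) = - t - min(t, 1/2)\<close> at the two vertices are
  solutions; they agree at the vertices at time \<open>0\<close>, but \<open>u > v\<close> at the vertices afterwards.\<close>

end

theory Submission
  imports Defs
begin

text \<open>If \<open>u > v\<close> at some vertex, let \<open>m > 0\<close> be the maximum of \<open>u - v\<close> over the vertices up to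
  some time, and let \<open>t\<close> be the first time at which it is attained, at the vertex \<open>x\<close> say. The
  minimum defining the flux operator of \<open>v\<close> at \<open>(x, t)\<close> is attained on an arc \<open>\<gamma>\<close> at a time
  \<open>r \<le> t\<close>, so that \<open>F\<^sub>\<gamma>[u](1, r) \<ge> F\<^sub>\<gamma>[v](1, r) + m\<close>. But \<open>u \<le> v + m\<close> at the initial point of
  \<open>\<gamma>\<close>, with strict inequality before \<open>t\<close>, and crossing an arc takes a positive time, so that the
  opposite strict inequality holds. The strictness is obtained by comparing with \<open>F\<^sub>\<gamma>[v]\<close> a convex
  combination of \<open>F\<^sub>\<gamma>[u]\<close> and a steep affine subsolution. Only smooth functions are ever added to
  viscosity subsolutions, so no doubling of variables is needed.\<close>

section \<open>Scaling viscosity subsolutions and adding smooth functions\<close>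

text \<open>If \<open>\<phi>\<close> touches \<open>a * w + \<xi>\<close> from above, then
  \<open>(\<phi> - \<xi>) / a\<close> touches \<open>w\<close> from above at the same point, and
  \<open>le\<close> carries the inequality back. It is applied with \<open>a = 1\<close> and
  \<open>\<xi>\<close> a function of time, and with \<open>a = 1 - l\<close> and
  \<open>\<xi>\<close> affine, where \<open>le\<close> is convexity of \<open>h s\<close>.\<close>

lemma viscosity_subsolution_affine:
  assumes w: "viscosity_subsolution h R w" and a: "0 < a"
    and d: "\<And>z. z \<in> R \<Longrightarrow> (\<xi> has_derivative (\<lambda>(x, y). \<xi>s z * x + \<xi>t z * y)) (at z)"
    and cs: "continuous_on R \<xi>s" and ct: "continuous_on R \<xi>t"
    and le: "\<And>s t p. (s, t) \<in> R \<Longrightarrow> \<xi>t (s, t) + h s (a * p + \<xi>s (s, t)) \<le> a * h s p"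
  shows "viscosity_subsolution h R (\<lambda>z. a * w z + \<xi> z)"
  unfolding viscosity_subsolution_def
proof (intro allI impI)
  fix \<phi> \<phi>s \<phi>t s t
  assume dphi: "\<forall>z\<in>R. (\<phi> has_derivative (\<lambda>(x, y). \<phi>s z * x + \<phi>t z * y)) (at z)"
    and cphi: "continuous_on R \<phi>s" "continuous_on R \<phi>t" and st: "(s, t) \<in> R"
    and ev: "\<forall>\<^sub>F z in nhds (s, t). a * w z + \<xi> z - \<phi> z \<le> a * w (s, t) + \<xi> (s, t) - \<phi> (s, t)"
  let ?\<psi> = "\<lambda>z. (\<phi> z - \<xi> z) / a"
  let ?\<psi>s = "\<lambda>z. (\<phi>s z - \<xi>s z) / a"
  let ?\<psi>t = "\<lambda>z. (\<phi>t z - \<xi>t z) / a"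
  have "(?\<psi> has_derivative (\<lambda>(x, y). ?\<psi>s z * x + ?\<psi>t z * y)) (at z)" if "z \<in> R" for z
  proof -
    have "((\<lambda>z. inverse a * (\<phi> z - \<xi> z)) has_derivative
        (\<lambda>v. inverse a * ((\<lambda>(x, y). \<phi>s z * x + \<phi>t z * y) v - (\<lambda>(x, y). \<xi>s z * x + \<xi>t z * y) v))) (at z)"
      using dphi d that by (intro derivative_intros) auto
    then show ?thesis
      by (rule has_derivative_eq_rhs[THEN has_derivative_transform_within, where d=1])
        (use a in \<open>auto simp: fun_eq_iff field_simps\<close>)
  qed
  moreover have "continuous_on R ?\<psi>s" "continuous_on R ?\<psi>t"
    using cphi cs ct a by (auto intro!: continuous_intros)
  moreover have "\<forall>\<^sub>F z in nhds (s, t). w z - ?\<psi> z \<le> w (s, t) - ?\<psi> (s, t)"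
  proof -
    have "w z - ?\<psi> z = (a * w z + \<xi> z - \<phi> z) / a" for z
      using a by (simp add: field_simps)
    then show ?thesis
      using ev a by (auto elim!: eventually_mono intro: divide_right_mono simp del: add_divide_distrib)
  qed
  ultimately have "?\<psi>t (s, t) + h s (?\<psi>s (s, t)) \<le> 0"
    using w[unfolded viscosity_subsolution_def, rule_format, of ?\<psi> ?\<psi>s ?\<psi>t s t] st by blast
  then have "\<phi>t (s, t) - \<xi>t (s, t) + a * h s (?\<psi>s (s, t)) \<le> 0"
    using a by (simp add: field_simps)
  moreover have "\<xi>t (s, t) + h s (\<phi>s (s, t)) \<le> a * h s (?\<psi>s (s, t))"
    using le[OF st, of "?\<psi>s (s, t)"] a by simp
  ultimately show "\<phi>t (s, t) + h s (\<phi>s (s, t)) \<le> 0"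
    by linarith
qed

section \<open>Uniformly continuous functions\<close>

text \<open>A segment in \<open>S\<close> is cut into pieces shorter than the modulus of continuity
  for \<open>e\<close>, each of which costs at most \<open>e\<close>; their number grows linearly
  with the distance. This controls the side condition on a possibly unbounded time interval.\<close>

lemma uniformly_continuous_on_linear_growth:
  fixes f :: "'a::real_normed_vector \<Rightarrow> 'b::metric_space"
  assumes uc: "uniformly_continuous_on S f" and S: "convex S" and e: "0 < e"
  obtains L where "0 \<le> L" "\<And>x y. x \<in> S \<Longrightarrow> y \<in> S \<Longrightarrow> dist (f x) (f y) \<le> e + L * dist x y"
proof -
  obtain d where d: "d > 0" "\<And>x y. x \<in> S \<Longrightarrow> y \<in> S \<Longrightarrow> dist x y < d \<Longrightarrow> dist (f x) (f y) < e"
    using uc e unfolding uniformly_continuous_on_def by (metis dist_commute)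
  \<comment> \<open>Pieces of length \<open>d / 2\<close> keep the distance strictly below
    \<open>d\<close>.\<close>
  have steps: "dist (f x) (f y) \<le> n * e" if "x \<in> S" "y \<in> S" "dist x y \<le> n * (d / 2)" for n :: nat and x y
    using that
  proof (induction n arbitrary: x)
    case 0
    then show ?case by simp
  next
    case (Suc n)
    \<comment> \<open>The first point of the subdivision of the segment from \<open>x\<close> to
      \<open>y\<close> into \<open>Suc n\<close> equal pieces.\<close>
    define z where "z = x + (1 / Suc n) *\<^sub>R (y - x)"
    have z: "z = (1 - 1 / Suc n) *\<^sub>R x + (1 / Suc n) *\<^sub>R y"
      by (simp add: z_def algebra_simps)
    then have "z \<in> S"
      using S Suc.prems by (auto intro!: convexD)
    have "dist x y = Suc n * dist x z"
      by (simp add: z_def dist_norm norm_minus_commute)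
    then have xz: "dist x z \<le> d / 2"
      using Suc.prems(3) by (simp only: mult_le_cancel_left_pos of_nat_0_less_iff zero_less_Suc)
    have "z - y = (1 - 1 / Suc n) *\<^sub>R (x - y)"
      by (simp add: z algebra_simps)
    then have "dist z y = (1 - 1 / Suc n) * dist x y"
      by (simp add: dist_norm)
    also have "\<dots> \<le> (1 - 1 / Suc n) * (Suc n * (d / 2))"
      using Suc.prems(3) by (intro mult_left_mono) auto
    also have "\<dots> = n * (d / 2)"
      by (simp add: field_simps)
    finally have "dist (f z) (f y) \<le> n * e"
      using Suc.IH \<open>z \<in> S\<close> Suc.prems by blast
    moreover have "dist (f x) (f z) < e"
      using d xz \<open>z \<in> S\<close> Suc.prems by auto
    moreover have "dist (f x) (f y) \<le> dist (f x) (f z) + dist (f z) (f y)"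
      by (rule dist_triangle)
    ultimately show ?case
      by (simp add: algebra_simps)
  qed
  show thesis
  proof (rule that[of "2 * e / d"])
    show "0 \<le> 2 * e / d"
      using d e by simp
  next
    fix x y assume xy: "x \<in> S" "y \<in> S"
    define n where "n = nat \<lceil>dist x y / (d / 2)\<rceil>"
    have "0 \<le> dist x y / (d / 2)"
      using d by simp
    then have n: "dist x y / (d / 2) \<le> n" "n \<le> dist x y / (d / 2) + 1"
      unfolding n_def by linarith+
    then have "dist (f x) (f y) \<le> n * e"
      using d xy by (intro steps) (auto simp: field_simps)
    also have "\<dots> \<le> (dist x y / (d / 2) + 1) * e"
      using n e by (intro mult_right_mono) auto
    finally show "dist (f x) (f y) \<le> e + 2 * e / d * dist x y"
      by (simp add: field_simps)
  qed
qed

lemma convex_times_co: "convex (times_co T0 T1)"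
  unfolding times_co_def
  by (intro is_interval_convex, unfold is_interval_1) (auto intro: le_less_trans[rotated])

lemma uniformly_continuous_on_subset:
  fixes f :: "'a::metric_space \<Rightarrow> 'b::metric_space"
  shows "uniformly_continuous_on S f \<Longrightarrow> T \<subseteq> S \<Longrightarrow> uniformly_continuous_on T f"
  unfolding uniformly_continuous_on_def by (meson subsetD)

lemma uniformly_continuous_on_Pair_left:
  fixes w :: "'a::metric_space \<times> 'b::metric_space \<Rightarrow> 'c::metric_space"
  assumes "uniformly_continuous_on (A \<times> B) w" and "a \<in> A"
  shows "uniformly_continuous_on B (\<lambda>t. w (a, t))"
  using assms unfolding uniformly_continuous_on_def by (fastforce simp: dist_Pair_Pair)

section \<open>Comparison with the maximal subsolution on one arc\<close>

text \<open>Subtracting a smooth nondecreasing function of time preserves subsolutions, so the side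
  condition after \<open>t1\<close> can be enforced without changing \<open>w\<close> much before \<open>t1\<close>.\<close>

lemma maximal_subsolution_ge:
  assumes W: "maximal_subsolution h T0 T1 f g W"
    and uc: "uniformly_continuous_on ({0..1} \<times> times_co T0 T1) w"
    and vs: "viscosity_subsolution h ({0<..<1} \<times> times_oo T0 T1) w"
    and g: "uniformly_continuous_on (times_co T0 T1) g"
    and t1: "t1 \<in> times_co T0 T1"
    and bottom: "\<And>s. s \<in> {0..1} \<Longrightarrow> w (s, T0) \<le> f s + K"
    and side: "\<And>t. t \<in> {T0..t1} \<Longrightarrow> w (0, t) \<le> g t + K"
    and st: "s \<in> {0..1}" "t \<in> {T0..t1}"
  shows "w (s, t) \<le> W (s, t) + K"
proof (rule field_le_epsilon)
  fix e :: real assume e: "0 < e"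
  let ?d = "\<lambda>t. w (0, t) - g t"
  have "uniformly_continuous_on (times_co T0 T1) ?d"
    using uniformly_continuous_on_Pair_left[OF uc, of 0] g
    by (intro continuous_intros) auto
  then obtain L where L: "0 \<le> L" and
    growth: "\<And>x y. x \<in> times_co T0 T1 \<Longrightarrow> y \<in> times_co T0 T1 \<Longrightarrow>
      dist (?d x) (?d y) \<le> e / 2 + L * dist x y"
    using uniformly_continuous_on_linear_growth[OF _ convex_times_co, of T0 T1 ?d "e / 2"] e by auto
  \<comment> \<open>The summand 1 covers the case \<open>L = 0\<close>.\<close>
  define \<theta> where "\<theta> = e / (2 * (L + 1))"
  have \<theta>: "\<theta> > 0" "L * \<theta> \<le> e / 2"
    using e L by (auto simp: \<theta>_def field_simps)
  \<comment> \<open>A smooth nondecreasing majorant of twice the positive part of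
    \<open>t - t1\<close>, at most \<open>\<theta>\<close> up to \<open>t1\<close>.\<close>
  define \<rho> where "\<rho> = (\<lambda>t. (t - t1) + sqrt ((t - t1)\<^sup>2 + \<theta>\<^sup>2))"
  define \<rho>' where "\<rho>' = (\<lambda>t. 1 + (t - t1) / sqrt ((t - t1)\<^sup>2 + \<theta>\<^sup>2))"
  define \<eta> where "\<eta> t = K + e / 2 + L * \<rho> t" for t
  have pos: "(x - t1)\<^sup>2 + \<theta>\<^sup>2 > 0" for x
    using \<theta> by (simp add: add_nonneg_pos)
  have root: "\<bar>x - t1\<bar> \<le> sqrt ((x - t1)\<^sup>2 + \<theta>\<^sup>2)" for x
    by (rule real_le_rsqrt) simp
  have \<rho>0: "0 \<le> \<rho> x" and \<rho>1: "x - t1 \<le> \<rho> x" for x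
    using root[of x] unfolding \<rho>_def abs_le_iff by linarith+
  have \<rho>\<theta>: "\<rho> x \<le> \<theta>" if "x \<le> t1" for x
    using sqrt_add_le_add_sqrt[of "(x - t1)\<^sup>2" "\<theta>\<^sup>2"] that \<theta> by (simp add: \<rho>_def)
  have \<rho>'0: "0 \<le> \<rho>' x" for x
  proof -
    have "0 < sqrt ((x - t1)\<^sup>2 + \<theta>\<^sup>2)"
      using pos[of x] by (simp only: real_sqrt_gt_0_iff)
    then have "\<rho>' x = \<rho> x / sqrt ((x - t1)\<^sup>2 + \<theta>\<^sup>2)"
      unfolding \<rho>'_def \<rho>_def using \<theta> by (simp add: add_divide_distrib)
    then show ?thesis
      using \<rho>0[of x] by simp
  qed
  have d\<rho>: "(\<rho> has_real_derivative \<rho>' x) (at x)" for x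
  proof -
    have "((\<lambda>t. (t - t1)\<^sup>2 + \<theta>\<^sup>2) has_real_derivative 2 * (x - t1)) (at x)"
      by (auto intro!: derivative_eq_intros)
    then have "((\<lambda>t. sqrt ((t - t1)\<^sup>2 + \<theta>\<^sup>2)) has_real_derivative
        inverse (sqrt ((x - t1)\<^sup>2 + \<theta>\<^sup>2)) / 2 * (2 * (x - t1))) (at x)"
      by (rule DERIV_chain2[where f=sqrt, rotated]) (rule DERIV_real_sqrt[OF pos[of x]])
    then have "(\<rho> has_real_derivative
        1 - 0 + inverse (sqrt ((x - t1)\<^sup>2 + \<theta>\<^sup>2)) / 2 * (2 * (x - t1))) (at x)"
      unfolding \<rho>_def by (rule DERIV_add[OF DERIV_diff[OF DERIV_ident DERIV_const]])
    moreover have "1 - 0 + inverse y / 2 * (2 * (x - t1)) = 1 + (x - t1) / y" for y :: real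
      by (cases "y = 0") (simp_all add: field_simps)
    ultimately show ?thesis
      unfolding \<rho>'_def by (simp only:)
  qed
  have c\<rho>': "continuous_on UNIV \<rho>'"
    unfolding \<rho>'_def using \<theta> by (intro continuous_intros) auto
  have uc\<rho>: "uniformly_continuous_on UNIV \<rho>"
  proof -
    \<comment> \<open>The square root is the Euclidean norm of \<open>(t - t1, \<theta>)\<close>, so
      the norm rule yields uniform continuity.\<close>
    have eq: "\<rho> = (\<lambda>t. (t - t1) + norm (t *\<^sub>R (1, 0) + (- t1, \<theta>)))"
      by (simp add: \<rho>_def norm_Pair fun_eq_iff)
    show ?thesis
      unfolding eq by (intro continuous_intros uniformly_continuous_on_id
          bounded_linear.uniformly_continuous_on[OF bounded_linear_scaleR_left])
  qed
  let ?w = "\<lambda>z. 1 * w z + - \<eta> (snd z)"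
  have "viscosity_subsolution h ({0<..<1} \<times> times_oo T0 T1) ?w"
  proof (rule viscosity_subsolution_affine[OF vs, where \<xi>s="\<lambda>_. 0" and \<xi>t="\<lambda>z. - L * \<rho>' (snd z)"])
    fix z :: "real \<times> real"
    have "((\<lambda>z. \<rho> (snd z)) has_derivative (\<lambda>v. \<rho>' (snd z) * snd v)) (at z)"
      using has_derivative_compose[OF has_derivative_snd[OF has_derivative_ident]
          d\<rho>[unfolded has_field_derivative_def]] .
    then show "((\<lambda>z. - \<eta> (snd z)) has_derivative (\<lambda>(x, y). 0 * x + - L * \<rho>' (snd z) * y)) (at z)"
      unfolding \<eta>_def by (auto intro!: derivative_eq_intros simp: fun_eq_iff algebra_simps)
  next
    show "continuous_on ({0<..<1} \<times> times_oo T0 T1) (\<lambda>z. - L * \<rho>' (snd z))"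
      by (intro continuous_intros continuous_on_compose2[OF c\<rho>']) auto
  qed (use L \<rho>'0 in auto)
  moreover have "uniformly_continuous_on ({0..1} \<times> times_co T0 T1) ?w"
  proof -
    have "uniformly_continuous_on ({0..1} \<times> times_co T0 T1) (\<lambda>z::real \<times> real. \<rho> (snd z))"
      by (rule uniformly_continuous_on_compose[OF
            bounded_linear.uniformly_continuous_on[OF bounded_linear_snd uniformly_continuous_on_id]
            uniformly_continuous_on_subset[OF uc\<rho> subset_UNIV]])
    with uc show ?thesis
      unfolding \<eta>_def by (intro continuous_intros)
  qed
  moreover have "?w (s, T0) \<le> f s" if "s \<in> {0..1}" for s
  proof -
    have "0 \<le> L * \<rho> T0" using L \<rho>0 by simp
    then show ?thesis using bottom[OF that] e by (simp add: \<eta>_def)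
  qed
  moreover have "?w (0, t) \<le> g t" if "t \<in> times_oo T0 T1" for t
  proof (cases "t \<le> t1")
    case True
    have "0 \<le> L * \<rho> t" using L \<rho>0 by simp
    then show ?thesis using True side[of t] that e by (simp add: \<eta>_def times_oo_def)
  next
    case False
    have "?d t1 \<le> K"
      using side[of t1] t1 by (simp add: times_co_def)
    moreover have "dist (?d t1) (?d t) \<le> e / 2 + L * dist t1 t"
      using that by (intro growth t1) (simp add: times_co_def times_oo_def)
    moreover have "L * dist t1 t \<le> L * \<rho> t"
      using L \<rho>1[of t] False by (intro mult_left_mono) (auto simp: dist_real_def)
    ultimately show ?thesis
      by (simp add: \<eta>_def dist_real_def abs_if split: if_splits)
  qed
  ultimately have "admissible_subsolution h T0 T1 f g ?w"
    by (auto simp: admissible_subsolution_def)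
  moreover have "(s, t) \<in> {0..1} \<times> times_co T0 T1"
    using st t1 by (auto simp: times_co_def intro: le_less_trans[rotated])
  ultimately have "?w (s, t) \<le> W (s, t)"
    using W by (auto simp: maximal_subsolution_def)
  moreover have "L * \<rho> t \<le> e / 2"
    using mult_left_mono[OF \<rho>\<theta>[of t] L] st \<theta> by auto
  ultimately show "w (s, t) \<le> W (s, t) + K + e"
    by (simp add: \<eta>_def)
qed

text \<open>The strict inequality comes from the fact that information cannot cross the arc
  instantaneously: by convexity, \<open>w\<close> may be averaged with an affine subsolution whose slope in
  \<open>s\<close> is so large that it lies below \<open>w\<close> on the side \<open>s = 0\<close> shortly before \<open>t1\<close>, but
  above \<open>w\<close> at \<open>(1, t1)\<close>.\<close>

lemma maximal_subsolution_gap: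
  assumes ham: "hamiltonian h"
    and W: "maximal_subsolution h T0 T1 f g W"
    and uc: "uniformly_continuous_on ({0..1} \<times> times_co T0 T1) w"
    and vs: "viscosity_subsolution h ({0<..<1} \<times> times_oo T0 T1) w"
    and g: "uniformly_continuous_on (times_co T0 T1) g"
    and t1: "t1 \<in> times_co T0 T1" and m: "0 < m"
    and bottom: "\<And>s. s \<in> {0..1} \<Longrightarrow> w (s, T0) \<le> f s"
    and before: "\<And>t. t \<in> {T0..<t1} \<Longrightarrow> w (0, t) < g t + m"
    and at: "w (0, t1) \<le> g t1 + m"
  shows "w (1, t1) < W (1, t1) + m"
proof -
  have t1': "T0 \<le> t1" and sub: "{T0..t1} \<subseteq> times_co T0 T1"
    using t1 by (auto simp: times_co_def intro: le_less_trans[rotated])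
  have "compact (w ` ({0..1} \<times> {T0..t1}))"
    using uc sub by (intro compact_continuous_image compact_Times)
      (auto dest!: uniformly_continuous_imp_continuous elim!: continuous_on_subset)
  then obtain B where "B > 0" and B: "\<And>s t. s \<in> {0..1} \<Longrightarrow> t \<in> {T0..t1} \<Longrightarrow> \<bar>w (s, t)\<bar> \<le> B"
    by (force dest!: compact_imp_bounded simp: bounded_pos)
  \<comment> \<open>The slope makes \<open>\<Psi> (1, t1) = B + 1\<close>, which exceeds
    \<open>w (1, t1)\<close>, although \<open>\<Psi> (0, t1) = - B - 2\<close>.\<close>
  define P where "P = 2 * B + 3"
  have "continuous_on {0..1} ((\<lambda>(s, p). h s p) \<circ> (\<lambda>s. (s, P)))"
    using ham unfolding hamiltonian_def
    by (intro continuous_on_compose continuous_intros) (auto elim: continuous_on_subset)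
  then have "compact ((\<lambda>s. h s P) ` {0..1})"
    by (intro compact_continuous_image) (auto simp: o_def)
  then obtain C where "C > 0" and C: "\<And>s. s \<in> {0..1} \<Longrightarrow> h s P \<le> C"
    by (force dest!: compact_imp_bounded simp: bounded_pos)
  \<comment> \<open>Going back in time by \<open>\<delta>\<close> raises \<open>\<Psi>\<close> by 1,
    so on the side \<open>s = 0\<close> it stays below \<open>- B\<close>, hence below
    \<open>w\<close>, between \<open>t1 - \<delta>\<close> and \<open>t1\<close>.\<close>
  define \<delta> where "\<delta> = 1 / C"
  have "\<delta> > 0"
    using \<open>C > 0\<close> by (simp add: \<delta>_def)
  define \<Psi> where "\<Psi> z = - B - 2 + P * fst z - C * (snd z - t1)" for z :: "real \<times> real"
  define D where "D = 4 * B + 6 + C * (t1 - T0)"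
  have "D > 0"
    using \<open>B > 0\<close> \<open>C > 0\<close> t1' by (simp add: D_def add_pos_nonneg)
  have diff: "\<Psi> (s, t) - w (s, t) \<le> D" if "s \<in> {0..1}" "t \<in> {T0..t1}" for s t
  proof -
    have "P * s \<le> P * 1" "C * (t1 - t) \<le> C * (t1 - T0)"
      using that \<open>B > 0\<close> \<open>C > 0\<close> by (auto simp: P_def intro!: mult_left_mono)
    then show ?thesis
      using B[OF that] \<open>B > 0\<close> by (simp add: \<Psi>_def D_def P_def algebra_simps)
  qed
  \<comment> \<open>Compactness turns the pointwise strict inequality into a uniform one away from
    \<open>t1\<close>; if the interval is empty, any number below \<open>m\<close> serves.\<close>
  obtain m' where m': "m' < m" and m'_le: "\<And>t. t \<in> {T0..t1 - \<delta>} \<Longrightarrow> w (0, t) - g t \<le> m'"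
  proof (cases "T0 \<le> t1 - \<delta>")
    case True
    have "{T0..t1 - \<delta>} \<subseteq> times_co T0 T1"
      using \<open>\<delta> > 0\<close> by (intro order_trans[OF _ sub]) auto
    then have "continuous_on {T0..t1 - \<delta>} (\<lambda>t. w (0, t) - g t)"
      using uniformly_continuous_on_Pair_left[OF uc, of 0] g
      by (intro continuous_intros) (auto dest!: uniformly_continuous_imp_continuous elim!: continuous_on_subset)
    then obtain r where r: "r \<in> {T0..t1 - \<delta>}"
      "\<And>t. t \<in> {T0..t1 - \<delta>} \<Longrightarrow> w (0, t) - g t \<le> w (0, r) - g r"
      using continuous_attains_sup[of "{T0..t1 - \<delta>}" "\<lambda>t. w (0, t) - g t"] True by auto
    have "r < t1"
      using r(1) \<open>\<delta> > 0\<close> by simp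
    then have "w (0, r) - g r < m"
      using before[of r] r by simp
    with r show ?thesis
      by (intro that[of "w (0, r) - g r"]) auto
  next
    case False
    then show ?thesis
      by (intro that[of "m - 1"]) auto
  qed
  \<comment> \<open>Averaging raises \<open>w\<close> by at most \<open>l * D\<close>. This is paid
    for by \<open>m\<close> at the initial time and by \<open>m - m'\<close> on the side up to
    \<open>t1 - \<delta>\<close>.\<close>
  define l where "l = min (1 / 2) (min m (m - m') / D)"
  have l: "0 < l" "l < 1"
    using m m' \<open>D > 0\<close> by (auto simp: l_def)
  have "l * D \<le> min m (m - m') / D * D"
    using \<open>D > 0\<close> by (intro mult_right_mono) (auto simp: l_def)
  then have lD: "l * D \<le> m" "l * D \<le> m - m'"
    using \<open>D > 0\<close> by auto
  let ?w = "\<lambda>z. (1 - l) * w z + l * \<Psi> z"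
  have eq: "?w z = w z + l * (\<Psi> z - w z)" for z
    by (simp add: algebra_simps)
  have "?w (1, t1) \<le> W (1, t1) + m"
  proof (rule maximal_subsolution_ge[OF W _ _ g t1])
    have "uniformly_continuous_on ({0..1} \<times> times_co T0 T1) \<Psi>"
      unfolding \<Psi>_def
      by (intro continuous_intros uniformly_continuous_on_id
          bounded_linear.uniformly_continuous_on[OF bounded_linear_fst, of _ "\<lambda>z. z"]
          bounded_linear.uniformly_continuous_on[OF bounded_linear_snd, of _ "\<lambda>z. z"])
    with uc show "uniformly_continuous_on ({0..1} \<times> times_co T0 T1) ?w"
      by (intro continuous_intros)
    show "viscosity_subsolution h ({0<..<1} \<times> times_oo T0 T1) ?w"
    proof (rule viscosity_subsolution_affine[OF vs, where \<xi>s="\<lambda>_. l * P" and \<xi>t="\<lambda>_. - l * C"])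
      show "((\<lambda>z. l * \<Psi> z) has_derivative (\<lambda>(x, y). l * P * x + - l * C * y)) (at z)" for z
        unfolding \<Psi>_def
        by (auto intro!: derivative_eq_intros simp: fun_eq_iff algebra_simps)
      fix s t p :: real
      assume "(s, t) \<in> {0<..<1} \<times> times_oo T0 T1"
      then have s: "s \<in> {0..1}" by auto
      then have "convex_on UNIV (h s)"
        using ham by (auto simp: hamiltonian_def)
      then have "h s ((1 - l) * p + l * P) \<le> (1 - l) * h s p + l * h s P"
        using convex_onD[of UNIV "h s" l p P] l by simp
      moreover have "l * h s P \<le> l * C"
        using C[OF s] l by simp
      ultimately show "- l * C + h s ((1 - l) * p + l * P) \<le> (1 - l) * h s p"
        by simp
    qed (use l in auto)
  next
    fix s :: real assume s: "s \<in> {0..1}"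
    have "l * (\<Psi> (s, T0) - w (s, T0)) \<le> l * D"
      using l diff[of s T0] s t1' by simp
    then show "?w (s, T0) \<le> f s + m"
      unfolding eq using lD bottom[OF s] by linarith
  next
    fix t assume t: "t \<in> {T0..t1}"
    show "?w (0, t) \<le> g t + m"
    proof (cases "t \<le> t1 - \<delta>")
      case True
      have "l * (\<Psi> (0, t) - w (0, t)) \<le> l * D"
        using l diff[of 0 t] t by simp
      then show ?thesis
        unfolding eq using lD m'_le[of t] t True by simp
    next
      case False
      then have "C * (t1 - t) \<le> 1"
        using \<open>C > 0\<close> by (simp add: \<delta>_def field_simps)
      then have "\<Psi> (0, t) - w (0, t) \<le> 0"
        using B[of 0 t] t by (simp add: \<Psi>_def algebra_simps)
      then have "l * (\<Psi> (0, t) - w (0, t)) \<le> 0"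
        using l by (simp add: mult_le_0_iff)
      moreover have "w (0, t) \<le> g t + m"
        using at before[of t] t by (cases "t = t1") auto
      ultimately show ?thesis
        unfolding eq by linarith
    qed
  qed (use t1' in auto)
  \<comment> \<open>At \<open>(1, t1)\<close> the average lies strictly above \<open>w\<close>, so
    the weak bound for it is a strict bound for \<open>w\<close>.\<close>
  moreover have "0 < l * (\<Psi> (1, t1) - w (1, t1))"
    using B[of 1 t1] t1' l by (simp add: \<Psi>_def P_def)
  ultimately show ?thesis
    unfolding eq by linarith
qed

section \<open>Attained extrema\<close>

text \<open>The minima over times and over arcs are interchanged: each arc has a minimizing time by
  compactness, and the best of the finitely many arcs is then chosen. Continuity is thus used only
  for the individual arcs.\<close>

lemma flux_vertex_operator_attained:
  assumes fin: "finite (arcs_to E x)" and ne: "arcs_to E x \<noteq> {}" and t: "T0 \<le> t"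
    and cont: "\<And>\<gamma>. \<gamma> \<in> arcs_to E x \<Longrightarrow> continuous_on {T0..t} (\<lambda>r. F \<gamma> (1, r))"
  shows "\<exists>\<gamma>\<in>arcs_to E x. \<exists>r\<in>{T0..t}.
    flux_operator T0 (vertex_operator E F x) a t = F \<gamma> (1, r) + a * (t - r)"
    and "\<gamma> \<in> arcs_to E x \<Longrightarrow> r \<in> {T0..t} \<Longrightarrow>
      flux_operator T0 (vertex_operator E F x) a t \<le> F \<gamma> (1, r) + a * (t - r)"
proof -
  let ?f = "\<lambda>\<gamma> r. F \<gamma> (1, r) + a * (t - r)"
  let ?g = "\<lambda>r. vertex_operator E F x r + a * (t - r)"
  have "\<exists>r\<in>{T0..t}. \<forall>r'\<in>{T0..t}. ?f \<gamma> r \<le> ?f \<gamma> r'" if "\<gamma> \<in> arcs_to E x" for \<gamma>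
  proof (rule continuous_attains_inf)
    show "continuous_on {T0..t} (?f \<gamma>)"
      by (rule continuous_on_add[OF cont[OF that]]) (intro continuous_intros)
  qed (use t in auto)
  then have "\<forall>\<gamma>\<in>arcs_to E x. \<exists>r. r \<in> {T0..t} \<and> (\<forall>r'\<in>{T0..t}. ?f \<gamma> r \<le> ?f \<gamma> r')"
    by blast
  from bchoice[OF this] obtain \<rho> where \<rho>: "\<And>\<gamma>. \<gamma> \<in> arcs_to E x \<Longrightarrow> \<rho> \<gamma> \<in> {T0..t}"
    "\<And>\<gamma> r'. \<gamma> \<in> arcs_to E x \<Longrightarrow> r' \<in> {T0..t} \<Longrightarrow> ?f \<gamma> (\<rho> \<gamma>) \<le> ?f \<gamma> r'"
    by blast
  obtain \<gamma>0 where "is_arg_min (\<lambda>\<gamma>. ?f \<gamma> (\<rho> \<gamma>)) (\<lambda>\<gamma>. \<gamma> \<in> arcs_to E x) \<gamma>0"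
    using ex_is_arg_min_if_finite[OF fin ne] by blast
  then have \<gamma>0: "\<gamma>0 \<in> arcs_to E x"
    "\<And>\<gamma>. \<gamma> \<in> arcs_to E x \<Longrightarrow> ?f \<gamma>0 (\<rho> \<gamma>0) \<le> ?f \<gamma> (\<rho> \<gamma>)"
    by (simp_all add: is_arg_min_linorder)
  have lower: "?f \<gamma>0 (\<rho> \<gamma>0) \<le> ?g r" if "r \<in> {T0..t}" for r
  proof -
    have "vertex_operator E F x r \<in> (\<lambda>\<gamma>. F \<gamma> (1, r)) ` arcs_to E x"
      unfolding vertex_operator_def using fin ne by (intro Min_in) auto
    then obtain \<gamma> where "\<gamma> \<in> arcs_to E x" "vertex_operator E F x r = F \<gamma> (1, r)"
      by auto
    then show ?thesis
      using \<gamma>0(2)[of \<gamma>] \<rho>(2)[of \<gamma> r] that by auto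
  qed
  \<comment> \<open>A real infimum is a lower bound only for sets bounded below, so this precedes
    any use of \<open>flux_operator\<close>.\<close>
  then have bdd: "bdd_below (?g ` {T0..t})"
    by (intro bdd_belowI2)
  have upper: "flux_operator T0 (vertex_operator E F x) a t \<le> ?f \<gamma> r"
    if "\<gamma> \<in> arcs_to E x" "r \<in> {T0..t}" for \<gamma> r
  proof -
    have "flux_operator T0 (vertex_operator E F x) a t \<le> ?g r"
      unfolding flux_operator_def by (rule cINF_lower[OF bdd that(2)])
    also have "vertex_operator E F x r \<le> F \<gamma> (1, r)"
      unfolding vertex_operator_def using fin that(1) by (intro Min_le) auto
    finally show ?thesis by simp
  qed
  then show "\<gamma> \<in> arcs_to E x \<Longrightarrow> r \<in> {T0..t} \<Longrightarrow>
      flux_operator T0 (vertex_operator E F x) a t \<le> F \<gamma> (1, r) + a * (t - r)"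
    by blast
  have "?f \<gamma>0 (\<rho> \<gamma>0) \<le> flux_operator T0 (vertex_operator E F x) a t"
    unfolding flux_operator_def using lower t by (intro cINF_greatest) auto
  with upper[of \<gamma>0 "\<rho> \<gamma>0"] \<gamma>0 \<rho>
  show "\<exists>\<gamma>\<in>arcs_to E x. \<exists>r\<in>{T0..t}.
    flux_operator T0 (vertex_operator E F x) a t = F \<gamma> (1, r) + a * (t - r)"
    by (intro bexI[of _ \<gamma>0] bexI[of _ "\<rho> \<gamma>0"]) auto
qed

text \<open>The maximizers form a nonempty compact set, on which the time coordinate attains its
  minimum.\<close>

lemma compact_continuous_first_maximum:
  fixes f :: "'a::topological_space \<times> real \<Rightarrow> real"
  assumes S: "compact S" "S \<noteq> {}" and f: "continuous_on S f"
  obtains x t where "(x, t) \<in> S" "\<And>z. z \<in> S \<Longrightarrow> f z \<le> f (x, t)"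
    "\<And>z. z \<in> S \<Longrightarrow> snd z < t \<Longrightarrow> f z < f (x, t)"
proof -
  obtain z0 where z0: "z0 \<in> S" "\<And>z. z \<in> S \<Longrightarrow> f z \<le> f z0"
    using continuous_attains_sup[OF S f] by blast
  let ?Z = "{z \<in> S. f z = f z0}"
  have "compact ?Z"
    using closedin_compact[OF S(1) continuous_closedin_preimage_constant[OF f]] .
  moreover have "?Z \<noteq> {}"
    using z0 by blast
  moreover have "continuous_on ?Z snd"
    by (rule continuous_on_snd[OF continuous_on_id])
  ultimately obtain z1 where z1: "z1 \<in> ?Z" "\<And>z. z \<in> ?Z \<Longrightarrow> snd z1 \<le> snd z"
    using continuous_attains_inf[of ?Z snd] by blast
  show thesis
  proof (rule that[of "fst z1" "snd z1"])
    fix z assume "z \<in> S" "snd z < snd z1"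
    then have "f z \<noteq> f z0"
      using z1(2)[of z] by auto
    then show "f z < f (fst z1, snd z1)"
      using z0(2)[OF \<open>z \<in> S\<close>] z1(1) by simp
  qed (use z0 z1 in auto)
qed

lemma semidiscrete_domain_vertices:
  "vertices E \<times> times_co T0 T1 \<subseteq> semidiscrete_domain E T0 T1"
  by (auto simp: semidiscrete_domain_def)

section \<open>Comparison on the network\<close>

theorem theorem6p3:
  fixes E :: "(real \<Rightarrow> real ^ 'n) set"
    and H :: "(real \<Rightarrow> real ^ 'n) \<Rightarrow> real \<Rightarrow> real \<Rightarrow> real"
    and c :: "real ^ 'n \<Rightarrow> real"
    and T0 :: real and T1 :: ereal
    and u v :: "(real ^ 'n) \<times> real \<Rightarrow> real"
  assumes "0 \<le> T0" and "ereal T0 < T1"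
    and "network E"
    and "network_hamiltonians E H"
    and "flux_limiter E H c"
    and "semidiscrete_subsolution E H c T0 T1 u"
    and "semidiscrete_supersolution E H c T0 T1 v"
    and "\<forall>y\<in>network_points E. u (y, T0) \<le> v (y, T0)"
  shows "\<forall>x\<in>vertices E. \<forall>t\<in>times_co T0 T1. u (x, t) \<le> v (x, t)"
proof (rule ccontr)
  assume "\<not> ?thesis"
  then obtain x0 t0 where x0: "x0 \<in> vertices E" and t0: "t0 \<in> times_co T0 T1"
    and gt: "v (x0, t0) < u (x0, t0)"
    by force
  have fin: "finite E" and rev: "\<And>\<gamma>. \<gamma> \<in> E \<Longrightarrow> reversepath \<gamma> \<in> E"
    using assms(3) by (auto simp: network_def)
  obtain Fu where Fu: "arc_operator E H T0 T1 u Fu" and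
    u_le: "\<And>x t. x \<in> vertices E \<Longrightarrow> t \<in> times_oo T0 T1 \<Longrightarrow>
      u (x, t) \<le> flux_operator T0 (vertex_operator E Fu x) (c x) t"
    using assms(6) by (auto simp: semidiscrete_subsolution_def)
  obtain Fv where Fv: "arc_operator E H T0 T1 v Fv" and
    v_ge: "\<And>x t. x \<in> vertices E \<Longrightarrow> t \<in> times_oo T0 T1 \<Longrightarrow>
      flux_operator T0 (vertex_operator E Fv x) (c x) t \<le> v (x, t)"
    using assms(7) by (auto simp: semidiscrete_supersolution_def)
  have ucu: "uniformly_continuous_on (vertices E \<times> times_co T0 T1) u"
    and ucv: "uniformly_continuous_on (vertices E \<times> times_co T0 T1) v"
    using assms(6,7) uniformly_continuous_on_subset[OF _ semidiscrete_domain_vertices]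
    by (auto simp: semidiscrete_subsolution_def semidiscrete_supersolution_def)
  \<comment> \<open>Stopping at \<open>t0\<close> gives a compact set, as there are finitely many
    vertices, and keeps the point where \<open>u\<close> exceeds \<open>v\<close>.\<close>
  let ?S = "vertices E \<times> {T0..t0}"
  have sub0: "{T0..t0} \<subseteq> times_co T0 T1"
    using t0 by (auto simp: times_co_def intro: le_less_trans[rotated])
  have cS: "compact ?S"
    using fin by (intro compact_Times[OF finite_imp_compact compact_Icc]) (simp add: vertices_def)
  have neS: "?S \<noteq> {}"
    using x0 t0 by (auto simp: times_co_def)
  have "?S \<subseteq> vertices E \<times> times_co T0 T1"
    using sub0 by auto
  then have "continuous_on ?S (\<lambda>z. u z - v z)"
    by (intro continuous_on_diff continuous_on_subset[OF uniformly_continuous_imp_continuous[OF ucu]]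
        continuous_on_subset[OF uniformly_continuous_imp_continuous[OF ucv]])
  then obtain x t where xt: "(x, t) \<in> ?S"
    and max: "\<And>z. z \<in> ?S \<Longrightarrow> u z - v z \<le> u (x, t) - v (x, t)"
    and first: "\<And>z. z \<in> ?S \<Longrightarrow> snd z < t \<Longrightarrow> u z - v z < u (x, t) - v (x, t)"
    using compact_continuous_first_maximum[OF cS neS] by blast
  define m where "m = u (x, t) - v (x, t)"
  have m: "0 < m"
    using max[of "(x0, t0)"] x0 t0 gt by (auto simp: m_def times_co_def)
  have x: "x \<in> vertices E" and t: "T0 \<le> t" "t \<le> t0"
    using xt by auto
  have vert: "vertices E \<subseteq> network_points E"
    by (force simp: vertices_def network_points_def pathstart_def pathfinish_def)
  \<comment> \<open>The semidiscrete inequalities are available only after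
    \<open>T0\<close>.\<close>
  have "t \<noteq> T0"
    using assms(8) m x vert by (force simp: m_def)
  then have oo: "t \<in> times_oo T0 T1"
    using t sub0 by (auto simp: times_oo_def times_co_def)
  have ne: "arcs_to E x \<noteq> {}"
    using x rev by (force simp: vertices_def arcs_to_def)
  have fin': "finite (arcs_to E x)"
    using fin by (simp add: arcs_to_def)
  have cont: "continuous_on {T0..t} (\<lambda>r. F \<gamma> (1, r))"
    if "arc_operator E H T0 T1 w F" "\<gamma> \<in> arcs_to E x" for F \<gamma> w
  proof -
    have "uniformly_continuous_on ({0..1} \<times> times_co T0 T1) (F \<gamma>)"
      using that by (auto simp: arc_operator_def arcs_to_def maximal_subsolution_def
          admissible_subsolution_def)
    from uniformly_continuous_on_Pair_left[OF this, of 1] show ?thesis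
      using sub0 t by (auto dest!: uniformly_continuous_imp_continuous elim!: continuous_on_subset)
  qed
  have cont_u: "\<And>\<gamma>. \<gamma> \<in> arcs_to E x \<Longrightarrow> continuous_on {T0..t} (\<lambda>r. Fu \<gamma> (1, r))"
    and cont_v: "\<And>\<gamma>. \<gamma> \<in> arcs_to E x \<Longrightarrow> continuous_on {T0..t} (\<lambda>r. Fv \<gamma> (1, r))"
    using cont[OF Fu] cont[OF Fv] by blast+
  \<comment> \<open>The pair that is optimal for \<open>v\<close> is a competitor in the infimum for
    \<open>u\<close>, so the term \<open>c x * (t - r)\<close> is common to both bounds.\<close>
  obtain \<gamma> r where \<gamma>: "\<gamma> \<in> arcs_to E x" and r: "r \<in> {T0..t}"
    and "flux_operator T0 (vertex_operator E Fv x) (c x) t = Fv \<gamma> (1, r) + c x * (t - r)"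
    using flux_vertex_operator_attained(1)[where F=Fv, OF fin' ne t(1) cont_v] by blast
  then have "Fv \<gamma> (1, r) + c x * (t - r) \<le> v (x, t)"
    using v_ge[OF x oo] by simp
  moreover have "u (x, t) \<le> Fu \<gamma> (1, r) + c x * (t - r)"
    using u_le[OF x oo] flux_vertex_operator_attained(2)[where F=Fu, OF fin' ne t(1) cont_u \<gamma> r]
    by (meson order_trans)
  moreover have "Fu \<gamma> (1, r) < Fv \<gamma> (1, r) + m"
  proof -
    have \<gamma>E: "\<gamma> \<in> E" and start: "pathstart \<gamma> \<in> vertices E"
      using \<gamma> by (auto simp: arcs_to_def vertices_def)
    have Wu: "admissible_subsolution (H \<gamma>) T0 T1 (\<lambda>s. u (\<gamma> s, T0)) (\<lambda>t. u (pathstart \<gamma>, t)) (Fu \<gamma>)"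
      using Fu \<gamma>E by (auto simp: arc_operator_def maximal_subsolution_def)
    have Wv: "maximal_subsolution (H \<gamma>) T0 T1 (\<lambda>s. v (\<gamma> s, T0)) (\<lambda>t. v (pathstart \<gamma>, t)) (Fv \<gamma>)"
      using Fv \<gamma>E by (auto simp: arc_operator_def)
    \<comment> \<open>The side condition holds only after \<open>T0\<close>; at \<open>T0\<close>
      the initial condition at \<open>s = 0\<close> replaces it.\<close>
    have side: "Fu \<gamma> (0, q) \<le> u (pathstart \<gamma>, q)" if "q \<in> {T0..t0}" for q
    proof (cases "q = T0")
      case True
      then show ?thesis
        using Wu by (auto simp: admissible_subsolution_def pathstart_def)
    next
      case False
      then have "q \<in> times_oo T0 T1"
        using that sub0 by (auto simp: times_oo_def times_co_def)
      then show ?thesis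
        using Wu by (auto simp: admissible_subsolution_def)
    qed
    show ?thesis
    \<comment> \<open>Taken at \<open>t1 = r\<close>: since \<open>r \<le> t\<close>,
      \<open>first\<close> gives strictness before \<open>r\<close>, while at \<open>r\<close>
      itself \<open>max\<close> gives the weak inequality.\<close>
    proof (rule maximal_subsolution_gap[OF _ Wv])
      show "hamiltonian (H \<gamma>)"
        using assms(4) \<gamma>E by (auto simp: network_hamiltonians_def)
      show "uniformly_continuous_on (times_co T0 T1) (\<lambda>t. v (pathstart \<gamma>, t))"
        by (rule uniformly_continuous_on_Pair_left[OF ucv start])
      show "r \<in> times_co T0 T1"
        using r t sub0 by auto
      show "Fu \<gamma> (0, q) < v (pathstart \<gamma>, q) + m" if "q \<in> {T0..<r}" for q
        using side[of q] first[of "(pathstart \<gamma>, q)"] that r t start by (auto simp: m_def)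
      show "Fu \<gamma> (0, r) \<le> v (pathstart \<gamma>, r) + m"
        using side[of r] max[of "(pathstart \<gamma>, r)"] r t start by (auto simp: m_def)
      show "Fu \<gamma> (s, T0) \<le> v (\<gamma> s, T0)" if "s \<in> {0..1}" for s
      proof -
        have "Fu \<gamma> (s, T0) \<le> u (\<gamma> s, T0)"
          using Wu that by (auto simp: admissible_subsolution_def)
        moreover have "\<gamma> s \<in> network_points E"
          unfolding network_points_def using that \<gamma>E by blast
        ultimately show ?thesis
          using assms(8) by force
      qed
    qed (use Wu m in \<open>auto simp: admissible_subsolution_def\<close>)
  qed
  \<comment> \<open>The chain gives \<open>u (x, t) < v (x, t) + m\<close>, whose right side equals
    \<open>u (x, t)\<close>.\<close>
  ultimately show False
    by (simp add: m_def)
qed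

end
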